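(* Let $X_m=\{(x_i,y_i)\}_{i=1}^m$ be a data set, let $p(y\mid x,w)>0$ be a parametric model with parameter $w\in W$, and let $\mathcal{L}_m[w]=-\frac1m\sum_{i=1}^m\log p(y_i\mid x_i,w)$ be the empirical log-loss. Let $\mathcal{W}\subset W$ be a subset on which the effective diffusion coefficient is a constant $D_\xi>0$, and let $p_s$ be the steady-state distribution of SGD on $\mathcal{W}$ with friction $\gamma=1$, i.e. $p_s(w)\propto e^{-\mathcal{L}_m[w]/D_\xi}$ for $w\in\mathcal{W}$. Then, as functions of $w\in\mathcal{W}$, $$p_s(w)^{mD_\xi}\propto p(X_m\mid w),$$ and consequently, for an arbitrary prior density $\rho$, the Bayesian posterior satisfies, for $w\in\mathcal{W}$, $$p(w\mid X_m)=\frac{\rho(w)\,p_s(w)^{mD_\xi}}{Z_{mD_\xi}},$$ where $Z_{mD_\xi}$ is the partition function (normalizing constant, independent of $w$).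
   Context: $W\subset\mathbb{R}^d$ is a compact parameter space. The likelihood is $p(X_m\mid w)=\prod_{i=1}^m p(y_i\mid x_i,w)$. The posterior is the local one on $\mathcal{W}$: $p(w\mid X_m)=\rho(w)p(X_m\mid w)/\int_{\mathcal{W}}\rho(w')p(X_m\mid w')\,dw'$, so $Z_{mD_\xi}=\int_{\mathcal{W}}\rho(w')p_s(w')^{mD_\xi}\,dw'$ (assumed finite and positive). The symbol $\propto$ means equality up to a positive factor not depending on $w\in\mathcal{W}$. The effective diffusion coefficient at length scale $\xi>0$ is $D_\xi(w)=\xi^{2-2\lambda(w)/d_s}$, with $\lambda(w)$ the local learning coefficient and $d_s$ the spectral dimension; here it enters only as a positive constant. The steady-state distribution $p_s$ is the normalized density $p_s(w)=e^{-\mathcal{L}_m[w]/D_\xi}/Z_s$ on $\mathcal{W}$, with $Z_s=\int_{\mathcal{W}}e^{-\mathcal{L}_m[w']/D_\xi}dw'$, which is the stationary solution on $\mathcal{W}$ of the SGD Fokker--Planck equation $\mathcal{D}^\alpha_t p=\nabla\cdot(D_\xi\nabla p+p\nabla\mathcal{L}_m)$ ($\mathcal{D}^\alpha_t$ the Caputo fractional time derivative). *)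

theory Defs
  imports "HOL-Analysis.Analysis"
begin

definition proportional_on :: "'a set \<Rightarrow> ('a \<Rightarrow> real) \<Rightarrow> ('a \<Rightarrow> real) \<Rightarrow> bool" where
  "proportional_on S f g \<longleftrightarrow> (\<exists>c>0. \<forall>w\<in>S. f w = c * g w)"

text \<open>Outcomes have densities with respect to a reference measure \<open>\<nu>\<close>, so discrete
  (counting measure) and continuous models are both covered.\<close>
definition parametric_model ::
  "'y measure \<Rightarrow> 'w set \<Rightarrow> ('y \<Rightarrow> 'x \<Rightarrow> 'w \<Rightarrow> real) \<Rightarrow> bool" where
  "parametric_model \<nu> W p \<longleftrightarrow>
     (\<forall>x. \<forall>w\<in>W. (\<lambda>y. p y x w) \<in> borel_measurable \<nu> \<and>
        (\<forall>y\<in>space \<nu>. p y x w > 0) \<and>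
        (\<integral>\<^sup>+ y. ennreal (p y x w) \<partial>\<nu>) = 1)"

definition likelihood ::
  "('y \<Rightarrow> 'x \<Rightarrow> 'w \<Rightarrow> real) \<Rightarrow> nat \<Rightarrow> (nat \<Rightarrow> 'x) \<Rightarrow> (nat \<Rightarrow> 'y) \<Rightarrow> 'w \<Rightarrow> real" where
  "likelihood p m x y w = (\<Prod>i=1..m. p (y i) (x i) w)"

definition empirical_log_loss ::
  "('y \<Rightarrow> 'x \<Rightarrow> 'w \<Rightarrow> real) \<Rightarrow> nat \<Rightarrow> (nat \<Rightarrow> 'x) \<Rightarrow> (nat \<Rightarrow> 'y) \<Rightarrow> 'w \<Rightarrow> real" where
  "empirical_log_loss p m x y w = - (1 / real m) * (\<Sum>i=1..m. ln (p (y i) (x i) w))"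

text \<open>Here \<open>lc w\<close> is the local learning coefficient at \<open>w\<close>, \<open>ds\<close> the spectral dimension and
  \<open>\<xi>\<close> the length scale.\<close>
definition effective_diffusion :: "real \<Rightarrow> real \<Rightarrow> ('w \<Rightarrow> real) \<Rightarrow> 'w \<Rightarrow> real" where
  "effective_diffusion \<xi> ds lc w = \<xi> powr (2 - 2 * lc w / ds)"

definition steady_state_const ::
  "(real ^ 'd) set \<Rightarrow> real \<Rightarrow> (real ^ 'd \<Rightarrow> real) \<Rightarrow> real" where
  "steady_state_const S D L = (LINT w:S|lebesgue. exp (- L w / D))"

text \<open>The Gibbs density on \<open>S\<close>. It is the zero-flux stationary solution of the
  Fokker--Planck equation with flux \<open>D \<nabla>p + p \<nabla>L\<close> (constant \<open>D\<close>, unit friction).\<close>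
definition steady_state ::
  "(real ^ 'd) set \<Rightarrow> real \<Rightarrow> (real ^ 'd \<Rightarrow> real) \<Rightarrow> real ^ 'd \<Rightarrow> real" where
  "steady_state S D L w = exp (- L w / D) / steady_state_const S D L"

definition prior_density :: "(real ^ 'd) set \<Rightarrow> (real ^ 'd \<Rightarrow> real) \<Rightarrow> bool" where
  "prior_density W \<rho> \<longleftrightarrow> (\<forall>w\<in>W. \<rho> w \<ge> 0) \<and> set_integrable lebesgue W \<rho> \<and>
     (LINT w:W|lebesgue. \<rho> w) = 1"

text \<open>The posterior is local: the evidence in the denominator is an integral over \<open>S\<close> only,
  even though the prior lives on the whole parameter space.\<close>
definition posterior ::
  "(real ^ 'd) set \<Rightarrow> (real ^ 'd \<Rightarrow> real) \<Rightarrow> (real ^ 'd \<Rightarrow> real) \<Rightarrow> real ^ 'd \<Rightarrow> real" where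
  "posterior S \<rho> lik w = \<rho> w * lik w / (LINT w':S|lebesgue. \<rho> w' * lik w')"

definition partition_fun ::
  "(real ^ 'd) set \<Rightarrow> (real ^ 'd \<Rightarrow> real) \<Rightarrow> (real ^ 'd \<Rightarrow> real) \<Rightarrow> real \<Rightarrow> real" where
  "partition_fun S \<rho> ps \<beta> = (LINT w:S|lebesgue. \<rho> w * ps w powr \<beta>)"

end

theory Submission
  imports Defs
begin

text \<open>Since \<open>m * L\<close> is the negative log-likelihood, raising the Gibbs weight \<open>exp (- L / D)\<close> to the
  power \<open>m * D\<close> recovers the likelihood, and the normalization of the Gibbs density contributes a
  constant factor. Bayes' rule is unchanged when the likelihood is rescaled by a constant.\<close>

text \<open>The factor \<open>m\<close> cancels the averaging \<open>1 / real m\<close>, which takes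
  \<open>m \<ge> 1\<close>; positivity makes \<open>exp\<close> undo \<open>ln\<close> in each
  factor of the product.\<close>

lemma likelihood_eq_exp_log_loss:
  assumes "m \<ge> 1" and "\<forall>i\<in>{1..m}. p (y i) (x i) w > 0"
  shows "likelihood p m x y w = exp (- (real m * empirical_log_loss p m x y w))"
proof -
  have "exp (- (real m * empirical_log_loss p m x y w)) = exp (\<Sum>i=1..m. ln (p (y i) (x i) w))"
    using assms(1) by (simp add: empirical_log_loss_def)
  also have "\<dots> = (\<Prod>i=1..m. p (y i) (x i) w)"
    unfolding exp_sum[OF finite_atLeastAtMost] using assms(2) by (intro prod.cong) auto
  finally show ?thesis
    by (simp add: likelihood_def)
qed

text \<open>The power distributes over the quotient, and \<open>D\<close> cancels in the exponent of
  the Gibbs weight: raising to \<open>\<beta> * D\<close> trades temperature \<open>D\<close> for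
  inverse temperature \<open>\<beta>\<close>.\<close>

lemma steady_state_powr:
  assumes "D > 0" and "steady_state_const S D L > 0"
  shows "steady_state S D L w powr (\<beta> * D) =
    steady_state_const S D L powr (- (\<beta> * D)) * exp (- (\<beta> * L w))"
proof -
  have "exp (- L w / D) powr (\<beta> * D) = exp (- (\<beta> * L w))"
    using assms(1) by (simp add: powr_def)
  then show ?thesis
    using assms(2) by (simp add: steady_state_def powr_divide powr_minus_divide)
qed

text \<open>The constant factor leaves the evidence integral and cancels against the one in the
  numerator.\<close>

lemma posterior_cong_proportional:
  assumes "proportional_on S f g" and "w \<in> S"
  shows "posterior S \<rho> f w = posterior S \<rho> g w"
proof -
  obtain c where c: "c > 0" "\<And>v. v \<in> S \<Longrightarrow> f v = c * g v"
    using assms(1) by (auto simp: proportional_on_def)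
  have "(LINT v:S|lebesgue. \<rho> v * f v) = (LINT v:S|lebesgue. c * (\<rho> v * g v))"
    \<comment> \<open>The indicator of \<open>S\<close> kills the integrand outside
      \<open>S\<close>, where \<open>f\<close> and \<open>g\<close> are unrelated.\<close>
    unfolding set_lebesgue_integral_def
    by (intro Bochner_Integration.integral_cong) (auto simp: indicator_def c(2))
  \<comment> \<open>If the integrand is not integrable, both integrals take the default value 0 and
    the equation still holds.\<close>
  then have "(LINT v:S|lebesgue. \<rho> v * f v) = c * (LINT v:S|lebesgue. \<rho> v * g v)"
    by simp
  then show ?thesis
    using c assms(2) by (simp add: posterior_def)
qed

theorem corollary3p2:
  fixes W S :: "(real ^ 'd) set"
    and \<nu> :: "'y measure"
    and p :: "'y \<Rightarrow> 'x \<Rightarrow> real ^ 'd \<Rightarrow> real"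
    and m :: nat
    and x :: "nat \<Rightarrow> 'x" and y :: "nat \<Rightarrow> 'y"
    and \<xi> ds D :: real
    and lc :: "real ^ 'd \<Rightarrow> real"
  defines "L \<equiv> empirical_log_loss p m x y"
    and "ps \<equiv> steady_state S D (empirical_log_loss p m x y)"
  assumes "compact W" and "S \<subseteq> W"
    and "parametric_model \<nu> W p"
    and "m \<ge> 1" and "\<forall>i\<in>{1..m}. y i \<in> space \<nu>"
    and "\<xi> > 0" and "ds > 0" and "D > 0"
    and "\<forall>w\<in>S. effective_diffusion \<xi> ds lc w = D"
    and "set_integrable lebesgue S (\<lambda>w. exp (- L w / D))"
    and "steady_state_const S D L > 0"
  shows "proportional_on S (\<lambda>w. ps w powr (real m * D)) (likelihood p m x y) \<and>
    (\<forall>\<rho>. prior_density W \<rho> \<longrightarrow>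
       set_integrable lebesgue S (\<lambda>w. \<rho> w * ps w powr (real m * D)) \<longrightarrow>
       partition_fun S \<rho> ps (real m * D) > 0 \<longrightarrow>
       (\<forall>w\<in>S. posterior S \<rho> (likelihood p m x y) w =
          \<rho> w * ps w powr (real m * D) / partition_fun S \<rho> ps (real m * D)))"
proof -
  let ?f = "\<lambda>w. ps w powr (real m * D)"
  \<comment> \<open>The factor that the normalizing constant contributes in
    \<open>steady_state_powr\<close> at \<open>\<beta> = m\<close>; the remaining exponential is the
    likelihood.\<close>
  define c where "c = steady_state_const S D L powr (- (real m * D))"
  have "?f w = c * likelihood p m x y w" if "w \<in> S" for w
  proof -
    have "\<forall>i\<in>{1..m}. p (y i) (x i) w > 0"
      using that assms by (auto simp: parametric_model_def)
    from likelihood_eq_exp_log_loss[where p = p and x = x and y = y, OF \<open>m \<ge> 1\<close> this] show ?thesis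
      using steady_state_powr[OF \<open>D > 0\<close> \<open>steady_state_const S D L > 0\<close>]
      by (simp add: c_def ps_def L_def)
  qed
  moreover have "c > 0"
    using \<open>steady_state_const S D L > 0\<close> by (simp add: c_def)
  ultimately have proportional: "proportional_on S ?f (likelihood p m x y)"
    by (auto simp: proportional_on_def)
  \<comment> \<open>\<open>partition_fun\<close> is the evidence integral with \<open>?f\<close> as
    likelihood, so the right-hand side is \<open>posterior S \<rho> ?f w\<close>.\<close>
  have "posterior S \<rho> (likelihood p m x y) w = \<rho> w * ?f w / partition_fun S \<rho> ps (real m * D)"
    if "w \<in> S" for \<rho> w
    using posterior_cong_proportional[OF proportional that, of \<rho>]
    by (simp add: posterior_def partition_fun_def)
  with proportional show ?thesis
    by blast
qed

end
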